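(* Let $(\Omega,\mathcal{A},\mu)$ be a nonatomic semifinite measure space. Then the set $\mathcal{S}_m\setminus\left(\mathcal{S}_p\cup\bigcup_{q>0}\mathcal{S}_{L_q}\right)$ is strongly $\mathfrak{c}$-algebrable.
   Context: $(\Omega,\mathcal{A},\mu)$ is a positive measure space with $\mu(\Omega)>0$. It is semifinite if $\mu(A)=\sup\{\mu(B):B\in\mathcal{A},\,B\subset A,\,\mu(B)<\infty\}$ for each $A\in\mathcal{A}$. An atom is a set $A\in\mathcal{A}$ with $\mu(A)>0$ for which there do not exist $B,C\in\mathcal{A}$ with $B\cap C=\varnothing$, $B\cup C=A$, $\mu(B)>0$ and $\mu(C)>0$; the measure space is nonatomic if it has no atoms. $L_0$ is the real vector space of ($\mu$-a.e. equality classes of) measurable functions $f:\Omega\to\mathbb{R}$. $L_0^{\mathbb{N}}$ is the commutative real algebra of all sequences $(f_n)_{n\in\mathbb{N}}$ in $L_0$ with coordinatewise operations, in particular $(f_n)\cdot(g_n):=(f_ng_n)$. Subsets of $L_0^{\mathbb{N}}$: $\mathcal{S}_p$: sequences with $f_n\to0$ pointwise almost everywhere. $\mathcal{S}_m$: $f_n\to0$ in measure ($\lim_n\mu(\{|f_n|>\varepsilon\})=0$ for every $\varepsilon>0$). $\mathcal{S}_{L_q}$ ($q\in(0,+\infty)$): $\lim_n\int_\Omega|f_n|^q\,d\mu=0$. $\mathfrak{c}$ is the cardinality of the continuum. A subset $A$ of a commutative algebra is strongly $\mathfrak{c}$-algebrable if there is a $\mathfrak{c}$-generated free algebra $M$ with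 $M\setminus\{0\}\subset A$; that is, there is a subset $B$ of the algebra of cardinality $\mathfrak{c}$ such that for any positive integer $N$, any nonzero real polynomial $P$ in $N$ variables without constant term and any distinct $x_1,\dots,x_N\in B$, one has $P(x_1,\dots,x_N)\in A\setminus\{0\}$. *)

theory Defs
  imports
    "HOL-Analysis.Analysis"
    "HOL-Algebra.Module"
    "HOL-Library.Poly_Mapping"
    "HOL-Library.Equipollence"
begin

section \<open>Semifinite and nonatomic measure spaces\<close>

text \<open>
  The locale \<open>semifinite_measure\<close> of \<open>HOL-Analysis.Complete_Measure\<close> does not express
  semifiniteness: its only axiom asks for some measurable subset of finite measure, without requiring
  positive measure, and the empty set is always one.
\<close>

definition semifinite :: "'a measure \<Rightarrow> bool" where
  "semifinite M \<longleftrightarrow>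
     (\<forall>A\<in>sets M. emeasure M A =
        (SUP B\<in>{B \<in> sets M. B \<subseteq> A \<and> emeasure M B < \<infinity>}. emeasure M B))"

definition atom :: "'a measure \<Rightarrow> 'a set \<Rightarrow> bool" where
  "atom M A \<longleftrightarrow> A \<in> sets M \<and> emeasure M A > 0 \<and>
     \<not> (\<exists>B\<in>sets M. \<exists>C\<in>sets M.
          B \<inter> C = {} \<and> B \<union> C = A \<and> emeasure M B > 0 \<and> emeasure M C > 0)"

definition nonatomic :: "'a measure \<Rightarrow> bool" where
  "nonatomic M \<longleftrightarrow> \<not> (\<exists>A. atom M A)"


section \<open>The space of classes of measurable functions\<close>

text \<open>
  Functions are total on the type \<open>'a\<close>, but measurability and the quantifier \<open>AE\<close> only see their
  values on \<open>space M\<close>; values outside \<open>space M\<close> are therefore identified by \<open>ae_rel M\<close>.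
\<close>

definition ae_rel :: "'a measure \<Rightarrow> (('a \<Rightarrow> real) \<times> ('a \<Rightarrow> real)) set" where
  "ae_rel M = {(f, g). f \<in> borel_measurable M \<and> g \<in> borel_measurable M \<and> (AE x in M. f x = g x)}"

definition L0 :: "'a measure \<Rightarrow> ('a \<Rightarrow> real) set set" where
  "L0 M = borel_measurable M // ae_rel M"

definition ae_class :: "'a measure \<Rightarrow> ('a \<Rightarrow> real) \<Rightarrow> ('a \<Rightarrow> real) set" where
  "ae_class M f = ae_rel M `` {f}"

definition L0_add :: "'a measure \<Rightarrow> ('a \<Rightarrow> real) set \<Rightarrow> ('a \<Rightarrow> real) set \<Rightarrow> ('a \<Rightarrow> real) set" where
  "L0_add M F G = (\<Union>f\<in>F. \<Union>g\<in>G. ae_class M (\<lambda>x. f x + g x))"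

definition L0_mult :: "'a measure \<Rightarrow> ('a \<Rightarrow> real) set \<Rightarrow> ('a \<Rightarrow> real) set \<Rightarrow> ('a \<Rightarrow> real) set" where
  "L0_mult M F G = (\<Union>f\<in>F. \<Union>g\<in>G. ae_class M (\<lambda>x. f x * g x))"

definition L0_smult :: "'a measure \<Rightarrow> real \<Rightarrow> ('a \<Rightarrow> real) set \<Rightarrow> ('a \<Rightarrow> real) set" where
  "L0_smult M c F = (\<Union>f\<in>F. ae_class M (\<lambda>x. c * f x))"

definition L0_seq :: "'a measure \<Rightarrow> (real, nat \<Rightarrow> ('a \<Rightarrow> real) set) module" where
  "L0_seq M =
     \<lparr>carrier = {F. \<forall>n. F n \<in> L0 M},
      mult = (\<lambda>F G n. L0_mult M (F n) (G n)),
      one = (\<lambda>n. ae_class M (\<lambda>x. 1)),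
      zero = (\<lambda>n. ae_class M (\<lambda>x. 0)),
      add = (\<lambda>F G n. L0_add M (F n) (G n)),
      smult = (\<lambda>c F n. L0_smult M c (F n))\<rparr>"

lemma equiv_ae_rel: "equiv (borel_measurable M) (ae_rel M)"
proof (rule equivI)
  show "ae_rel M \<subseteq> borel_measurable M \<times> borel_measurable M"
    by (auto simp: ae_rel_def)
  show "refl_on (borel_measurable M) (ae_rel M)"
    by (auto simp: ae_rel_def refl_on_def)
  show "sym (ae_rel M)"
    by (auto simp: ae_rel_def sym_def elim: AE_mp)
  show "trans (ae_rel M)"
  proof (rule transI)
    fix f g h assume fg: "(f, g) \<in> ae_rel M" and gh: "(g, h) \<in> ae_rel M"
    from fg have "AE x in M. f x = g x" by (simp add: ae_rel_def)
    moreover from gh have "AE x in M. g x = h x" by (simp add: ae_rel_def)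
    ultimately have "AE x in M. f x = h x" by eventually_elim simp
    with fg gh show "(f, h) \<in> ae_rel M" by (simp add: ae_rel_def)
  qed
qed

lemma ae_class_eq_iff:
  assumes "f \<in> borel_measurable M" "g \<in> borel_measurable M"
  shows "ae_class M f = ae_class M g \<longleftrightarrow> (AE x in M. f x = g x)"
  unfolding ae_class_def
  using eq_equiv_class_iff[OF equiv_ae_rel assms] assms by (simp add: ae_rel_def)

lemma mem_ae_class:
  "g \<in> ae_class M f \<longleftrightarrow>
     f \<in> borel_measurable M \<and> g \<in> borel_measurable M \<and> (AE x in M. f x = g x)"
  by (simp add: ae_class_def ae_rel_def)

lemma ae_class_in_L0: "f \<in> borel_measurable M \<Longrightarrow> ae_class M f \<in> L0 M"
  unfolding L0_def ae_class_def by (rule quotientI)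

lemma L0_cases:
  assumes "F \<in> L0 M"
  obtains f where "f \<in> borel_measurable M" "F = ae_class M f"
  using assms unfolding L0_def ae_class_def by (auto elim: quotientE)

lemma L0_add_class:
  assumes "f \<in> borel_measurable M" "g \<in> borel_measurable M"
  shows "L0_add M (ae_class M f) (ae_class M g) = ae_class M (\<lambda>x. f x + g x)"
proof -
  have "(\<lambda>f g. ae_class M (\<lambda>x. f x + g x)) respects2 ae_rel M"
  proof (rule congruent2I')
    fix f f' g g' assume *: "(f, f') \<in> ae_rel M" "(g, g') \<in> ae_rel M"
    then have "AE x in M. f x = f' x" "AE x in M. g x = g' x" by (simp_all add: ae_rel_def)
    then have "AE x in M. f x + g x = f' x + g' x" by eventually_elim simp
    then show "ae_class M (\<lambda>x. f x + g x) = ae_class M (\<lambda>x. f' x + g' x)"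
      using * by (subst ae_class_eq_iff) (auto simp: ae_rel_def)
  qed
  from UN_equiv_class2[OF equiv_ae_rel equiv_ae_rel this assms] show ?thesis
    unfolding L0_add_def by (simp add: ae_class_def)
qed

lemma L0_mult_class:
  assumes "f \<in> borel_measurable M" "g \<in> borel_measurable M"
  shows "L0_mult M (ae_class M f) (ae_class M g) = ae_class M (\<lambda>x. f x * g x)"
proof -
  have "(\<lambda>f g. ae_class M (\<lambda>x. f x * g x)) respects2 ae_rel M"
  proof (rule congruent2I')
    fix f f' g g' assume *: "(f, f') \<in> ae_rel M" "(g, g') \<in> ae_rel M"
    then have "AE x in M. f x = f' x" "AE x in M. g x = g' x" by (simp_all add: ae_rel_def)
    then have "AE x in M. f x * g x = f' x * g' x" by eventually_elim simp
    then show "ae_class M (\<lambda>x. f x * g x) = ae_class M (\<lambda>x. f' x * g' x)"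
      using * by (subst ae_class_eq_iff) (auto simp: ae_rel_def)
  qed
  from UN_equiv_class2[OF equiv_ae_rel equiv_ae_rel this assms] show ?thesis
    unfolding L0_mult_def by (simp add: ae_class_def)
qed

lemma L0_smult_class:
  assumes "f \<in> borel_measurable M"
  shows "L0_smult M c (ae_class M f) = ae_class M (\<lambda>x. c * f x)"
proof -
  have "(\<lambda>f. ae_class M (\<lambda>x. c * f x)) respects ae_rel M"
  proof (rule congruentI)
    fix f f' assume *: "(f, f') \<in> ae_rel M"
    then have "AE x in M. f x = f' x" by (simp add: ae_rel_def)
    then have "AE x in M. c * f x = c * f' x" by eventually_elim simp
    then show "ae_class M (\<lambda>x. c * f x) = ae_class M (\<lambda>x. c * f' x)"
      using * by (subst ae_class_eq_iff) (auto simp: ae_rel_def)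
  qed
  from UN_equiv_class[OF equiv_ae_rel this assms] show ?thesis
    unfolding L0_smult_def by (simp add: ae_class_def)
qed

lemma L0_seq_carrier_cases:
  assumes "F \<in> carrier (L0_seq M)"
  obtains f where "\<And>n. f n \<in> borel_measurable M" "F = (\<lambda>n. ae_class M (f n))"
proof -
  have "\<forall>n. \<exists>f. f \<in> borel_measurable M \<and> F n = ae_class M f"
  proof
    fix n
    from assms have "F n \<in> L0 M" by (simp add: L0_seq_def)
    then show "\<exists>f. f \<in> borel_measurable M \<and> F n = ae_class M f"
      by (rule L0_cases) blast
  qed
  then obtain f where "\<forall>n. f n \<in> borel_measurable M \<and> F n = ae_class M (f n)"
    by metis
  with that[of f] show ?thesis by auto
qed

definition real_ring :: "real ring" where
  "real_ring = \<lparr>carrier = UNIV, mult = (*), one = 1, zero = 0, add = (+)\<rparr>"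

lemma cring_real_ring: "cring real_ring"
proof (rule cringI)
  show "abelian_group real_ring"
  proof (rule abelian_groupI)
    fix x :: real
    show "\<exists>y\<in>carrier real_ring. y \<oplus>\<^bsub>real_ring\<^esub> x = \<zero>\<^bsub>real_ring\<^esub>"
      by (rule bexI[of _ "- x"]) (simp_all add: real_ring_def)
  qed (simp_all add: real_ring_def)
  show "Group.comm_monoid real_ring"
    by (rule comm_monoidI) (simp_all add: real_ring_def)
qed (simp add: real_ring_def algebra_simps)

lemmas L0_seq_simps =
  L0_seq_def L0_add_class L0_mult_class L0_smult_class ae_class_in_L0

lemma cring_L0_seq: "cring (L0_seq M)"
proof (rule cringI)
  show "abelian_group (L0_seq M)"
  proof (rule abelian_groupI)
    fix F assume "F \<in> carrier (L0_seq M)"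
    then obtain f where f: "\<And>n. f n \<in> borel_measurable M" "F = (\<lambda>n. ae_class M (f n))"
      using L0_seq_carrier_cases by blast
    show "\<exists>G\<in>carrier (L0_seq M). G \<oplus>\<^bsub>L0_seq M\<^esub> F = \<zero>\<^bsub>L0_seq M\<^esub>"
      by (rule bexI[of _ "\<lambda>n. ae_class M (\<lambda>x. - f n x)"]) (simp_all add: L0_seq_simps f)
  qed (((elim L0_seq_carrier_cases)?; simp add: L0_seq_simps ac_simps)+)
  show "Group.comm_monoid (L0_seq M)"
    by (rule comm_monoidI; (elim L0_seq_carrier_cases)?; simp add: L0_seq_simps ac_simps)
qed (elim L0_seq_carrier_cases; simp add: L0_seq_simps algebra_simps)

lemma algebra_L0_seq: "Module.algebra real_ring (L0_seq M)"
  by (rule algebraI[OF cring_real_ring cring_L0_seq];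
      (elim L0_seq_carrier_cases)?; simp add: L0_seq_simps real_ring_def algebra_simps)


section \<open>Modes of convergence to zero\<close>

text \<open>
  The three sets are given by the existence of a sequence of representatives with the respective
  property; the lemmas below show that any other choice of representatives is equivalent.
\<close>

definition S_p :: "'a measure \<Rightarrow> (nat \<Rightarrow> ('a \<Rightarrow> real) set) set" where
  "S_p M = {F \<in> carrier (L0_seq M). \<exists>f. (\<forall>n. f n \<in> F n) \<and>
     (AE x in M. (\<lambda>n. f n x) \<longlonglongrightarrow> 0)}"

definition S_m :: "'a measure \<Rightarrow> (nat \<Rightarrow> ('a \<Rightarrow> real) set) set" where
  "S_m M = {F \<in> carrier (L0_seq M). \<exists>f. (\<forall>n. f n \<in> F n) \<and>
     (\<forall>\<epsilon>>0. (\<lambda>n. emeasure M {x \<in> space M. \<bar>f n x\<bar> > \<epsilon>}) \<longlonglongrightarrow> 0)}"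

definition S_L :: "real \<Rightarrow> 'a measure \<Rightarrow> (nat \<Rightarrow> ('a \<Rightarrow> real) set) set" where
  "S_L q M = {F \<in> carrier (L0_seq M). \<exists>f. (\<forall>n. f n \<in> F n) \<and>
     (\<lambda>n. \<integral>\<^sup>+ x. ennreal (\<bar>f n x\<bar> powr q) \<partial>M) \<longlonglongrightarrow> 0}"

lemma ae_class_seq_in_carrier:
  "(\<And>n. f n \<in> borel_measurable M) \<Longrightarrow> (\<lambda>n. ae_class M (f n)) \<in> carrier (L0_seq M)"
  by (simp add: L0_seq_def ae_class_in_L0)

lemma S_p_iff:
  assumes f: "\<And>n. f n \<in> borel_measurable M"
  shows "(\<lambda>n. ae_class M (f n)) \<in> S_p M \<longleftrightarrow> (AE x in M. (\<lambda>n. f n x) \<longlonglongrightarrow> 0)"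
proof
  assume "(\<lambda>n. ae_class M (f n)) \<in> S_p M"
  then obtain g where g: "\<And>n. g n \<in> ae_class M (f n)" "AE x in M. (\<lambda>n. g n x) \<longlonglongrightarrow> 0"
    by (auto simp: S_p_def)
  have "AE x in M. \<forall>n. f n x = g n x"
    using g(1) by (simp add: AE_all_countable mem_ae_class)
  with g(2) show "AE x in M. (\<lambda>n. f n x) \<longlonglongrightarrow> 0"
    by eventually_elim simp
next
  assume "AE x in M. (\<lambda>n. f n x) \<longlonglongrightarrow> 0"
  then show "(\<lambda>n. ae_class M (f n)) \<in> S_p M"
    using f by (auto simp: S_p_def mem_ae_class intro!: ae_class_seq_in_carrier exI[of _ f])
qed

lemma S_m_iff:
  assumes f: "\<And>n. f n \<in> borel_measurable M"
  shows "(\<lambda>n. ae_class M (f n)) \<in> S_m M \<longleftrightarrow>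
    (\<forall>\<epsilon>>0. (\<lambda>n. emeasure M {x \<in> space M. \<bar>f n x\<bar> > \<epsilon>}) \<longlonglongrightarrow> 0)"
proof
  assume "(\<lambda>n. ae_class M (f n)) \<in> S_m M"
  then obtain g where g: "\<And>n. g n \<in> ae_class M (f n)"
    "\<forall>\<epsilon>>0. (\<lambda>n. emeasure M {x \<in> space M. \<bar>g n x\<bar> > \<epsilon>}) \<longlonglongrightarrow> 0"
    by (auto simp: S_m_def)
  have "emeasure M {x \<in> space M. \<bar>g n x\<bar> > \<epsilon>} = emeasure M {x \<in> space M. \<bar>f n x\<bar> > \<epsilon>}" for n \<epsilon>
  proof (rule emeasure_eq_AE)
    have [measurable]: "g n \<in> borel_measurable M" "f n \<in> borel_measurable M"
      using g(1)[of n] by (auto simp: mem_ae_class)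
    have "AE x in M. f n x = g n x"
      using g(1)[of n] by (simp add: mem_ae_class)
    then show "AE x in M. x \<in> {x \<in> space M. \<bar>g n x\<bar> > \<epsilon>} \<longleftrightarrow> x \<in> {x \<in> space M. \<bar>f n x\<bar> > \<epsilon>}"
      by eventually_elim simp
    show "{x \<in> space M. \<bar>g n x\<bar> > \<epsilon>} \<in> sets M" "{x \<in> space M. \<bar>f n x\<bar> > \<epsilon>} \<in> sets M"
      by measurable
  qed
  with g(2) show "\<forall>\<epsilon>>0. (\<lambda>n. emeasure M {x \<in> space M. \<bar>f n x\<bar> > \<epsilon>}) \<longlonglongrightarrow> 0"
    by simp
next
  assume "\<forall>\<epsilon>>0. (\<lambda>n. emeasure M {x \<in> space M. \<bar>f n x\<bar> > \<epsilon>}) \<longlonglongrightarrow> 0"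
  then show "(\<lambda>n. ae_class M (f n)) \<in> S_m M"
    using f by (auto simp: S_m_def mem_ae_class intro!: ae_class_seq_in_carrier exI[of _ f])
qed

lemma S_L_iff:
  assumes f: "\<And>n. f n \<in> borel_measurable M"
  shows "(\<lambda>n. ae_class M (f n)) \<in> S_L q M \<longleftrightarrow>
    (\<lambda>n. \<integral>\<^sup>+ x. ennreal (\<bar>f n x\<bar> powr q) \<partial>M) \<longlonglongrightarrow> 0"
proof
  assume "(\<lambda>n. ae_class M (f n)) \<in> S_L q M"
  then obtain g where g: "\<And>n. g n \<in> ae_class M (f n)"
    "(\<lambda>n. \<integral>\<^sup>+ x. ennreal (\<bar>g n x\<bar> powr q) \<partial>M) \<longlonglongrightarrow> 0"
    by (auto simp: S_L_def)
  have "(\<integral>\<^sup>+ x. ennreal (\<bar>g n x\<bar> powr q) \<partial>M) = (\<integral>\<^sup>+ x. ennreal (\<bar>f n x\<bar> powr q) \<partial>M)" for n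
  proof (rule nn_integral_cong_AE)
    have "AE x in M. f n x = g n x"
      using g(1)[of n] by (simp add: mem_ae_class)
    then show "AE x in M. ennreal (\<bar>g n x\<bar> powr q) = ennreal (\<bar>f n x\<bar> powr q)"
      by eventually_elim simp
  qed
  with g(2) show "(\<lambda>n. \<integral>\<^sup>+ x. ennreal (\<bar>f n x\<bar> powr q) \<partial>M) \<longlonglongrightarrow> 0"
    by simp
next
  assume "(\<lambda>n. \<integral>\<^sup>+ x. ennreal (\<bar>f n x\<bar> powr q) \<partial>M) \<longlonglongrightarrow> 0"
  then show "(\<lambda>n. ae_class M (f n)) \<in> S_L q M"
    using f by (auto simp: S_L_def mem_ae_class intro!: ae_class_seq_in_carrier exI[of _ f])
qed


section \<open>Strong \<open>\<cc>\<close>-algebrability\<close>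

text \<open>
  A real polynomial in the variables \<open>X\<^sub>0, X\<^sub>1, \<dots>\<close> is a finitely supported map from monomials (finitely
  supported exponent vectors) to coefficients. When the constant coefficient
  \<open>Poly_Mapping.lookup P 0\<close> vanishes, no empty product occurs in \<open>poly_eval\<close>.
\<close>

type_synonym real_mpoly = "(nat \<Rightarrow>\<^sub>0 nat) \<Rightarrow>\<^sub>0 real"

definition mpoly_in_vars :: "nat \<Rightarrow> real_mpoly \<Rightarrow> bool" where
  "mpoly_in_vars N P \<longleftrightarrow> (\<forall>m\<in>Poly_Mapping.keys P. Poly_Mapping.keys m \<subseteq> {..<N})"

definition poly_eval :: "(real, 'b, 'c) module_scheme \<Rightarrow> real_mpoly \<Rightarrow> (nat \<Rightarrow> 'b) \<Rightarrow> 'b" where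
  "poly_eval A P x =
     (\<Oplus>\<^bsub>A\<^esub>m\<in>Poly_Mapping.keys P. Poly_Mapping.lookup P m \<odot>\<^bsub>A\<^esub>
        (\<Otimes>\<^bsub>A\<^esub>i\<in>Poly_Mapping.keys m. x i [^]\<^bsub>A\<^esub> Poly_Mapping.lookup m i))"

definition strongly_continuum_algebrable :: "(real, 'b, 'c) module_scheme \<Rightarrow> 'b set \<Rightarrow> bool" where
  "strongly_continuum_algebrable A S \<longleftrightarrow>
     (\<exists>B \<subseteq> carrier A. B \<approx> (UNIV :: real set) \<and>
        (\<forall>N\<ge>1. \<forall>P. P \<noteq> 0 \<and> mpoly_in_vars N P \<and> Poly_Mapping.lookup P 0 = 0 \<longrightarrow>
           (\<forall>x. inj_on x {..<N} \<and> x ` {..<N} \<subseteq> B \<longrightarrow> poly_eval A P x \<in> S - {\<zero>\<^bsub>A\<^esub>})))"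

end

theory Submission
  imports Defs "HOL-Real_Asymp.Real_Asymp"
begin

text \<open>
  On a set \<open>A\<close> of positive finite measure choose sets \<open>E\<^sub>n\<close> of positive measure tending to 0 that cover
  every point of \<open>A\<close> infinitely often, and put \<open>u\<^sub>n = 1 / \<mu>(E\<^sub>n)\<close>. The free generators are the sequences
  \<open>exp (u\<^sub>n powr \<rho>) \<cdot> indicator E\<^sub>n\<close> with \<open>\<rho> > 0\<close>, parametrised by \<open>\<rho> = exp r\<close>. In a polynomial of them the exponents
  of distinct monomials differ by a quantity that tends to \<open>\<plusminus>\<infinity>\<close>, so one monomial dominates. On \<open>E\<^sub>n\<close> the
  polynomial is therefore eventually at least \<open>c \<cdot> exp (u\<^sub>n powr s)\<close> in absolute value with \<open>c, s > 0\<close>: this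
  prevents pointwise convergence, and each of its positive powers outgrows \<open>1 / \<mu>(E\<^sub>n)\<close>, whereas convergence in measure
  only needs \<open>\<mu>(E\<^sub>n) \<longlonglongrightarrow> 0\<close>.
\<close>

section \<open>Small sets in nonatomic spaces and a typewriter sequence\<close>

text \<open>A set that is not an atom splits into two parts of positive measure, and the smaller
  part has at most half the measure; iterate. Since \<open>measure\<close> is 0 on sets of infinite
  measure, \<open>0 < measure M B\<close> also says that \<open>B\<close> has finite
  measure.\<close>

lemma nonatomic_small_subset:
  assumes "nonatomic M" "B \<in> sets M" "0 < measure M B"
  shows "\<exists>C\<in>sets M. C \<subseteq> B \<and> 0 < measure M C \<and> measure M C \<le> measure M B / 2 ^ n"
proof (induction n)
  case 0
  show ?case using assms by auto
next
  case (Suc n)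
  then obtain C where C: "C \<in> sets M" "C \<subseteq> B" "0 < measure M C" "measure M C \<le> measure M B / 2 ^ n"
    by blast
  have fin: "emeasure M C \<noteq> \<infinity>" and pos: "emeasure M C > 0"
    using C(3) by (auto simp: measure_def zero_less_iff_neq_zero)
  from assms(1) pos C(1) obtain D D' where D: "D \<in> sets M" "D' \<in> sets M" "D \<inter> D' = {}" "D \<union> D' = C"
    "emeasure M D > 0" "emeasure M D' > 0"
    unfolding nonatomic_def atom_def by blast
  have "emeasure M D \<le> emeasure M C" "emeasure M D' \<le> emeasure M C"
    using D C(1) by (auto intro!: emeasure_mono)
  then have f: "emeasure M D \<noteq> \<infinity>" "emeasure M D' \<noteq> \<infinity>"
    using fin by (auto simp: top_unique)
  have sum: "measure M C = measure M D + measure M D'"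
    using measure_Union[OF f D(1-3)] D(4) by simp
  have p: "0 < measure M D" "0 < measure M D'"
    using D(5,6) f by (auto simp: measure_def enn2real_positive_iff less_top)
  show ?case
  proof (cases "measure M D \<le> measure M D'")
    case True
    then have "2 * measure M D \<le> measure M B / 2 ^ n" using sum C(4) by linarith
    then have "measure M D \<le> measure M B / 2 ^ Suc n" by simp
    then show ?thesis using D p C(2) by blast
  next
    case False
    then have "2 * measure M D' \<le> measure M B / 2 ^ n" using sum C(4) by linarith
    then have "measure M D' \<le> measure M B / 2 ^ Suc n" by simp
    then show ?thesis using D p C(2) by blast
  qed
qed

lemma nonatomic_subset_le:
  assumes "nonatomic M" "B \<in> sets M" "0 < measure M B" "0 < \<delta>"
  obtains C where "C \<in> sets M" "C \<subseteq> B" "0 < measure M C" "measure M C \<le> \<delta>"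
proof -
  have "(\<lambda>n. measure M B / 2 ^ n) \<longlonglongrightarrow> 0" by real_asymp
  then have "eventually (\<lambda>n. measure M B / 2 ^ n < \<delta>) sequentially"
    using assms(4) by (rule order_tendstoD)
  then obtain n where "measure M B / 2 ^ n < \<delta>" by (auto simp: eventually_sequentially)
  with nonatomic_small_subset[OF assms(1-3), of n] that show thesis by force
qed

text \<open>An exhaustion argument. Among the finite unions of small subsets of \<open>A\<close>,
  take a sequence whose measures approach their supremum. What it leaves uncovered is null, as
  otherwise a further small set could be added; so some finite stage leaves a remainder that is
  itself small and serves as the last piece.\<close>

lemma nonatomic_finite_cover_le:
  assumes na: "nonatomic M" and A: "A \<in> fmeasurable M" and \<delta>: "0 < \<delta>"
  obtains \<C> where "finite \<C>" "\<C> \<subseteq> sets M" "\<Union>\<C> = A" "\<forall>C\<in>\<C>. measure M C \<le> \<delta>"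
proof -
  define small where "small \<C> \<longleftrightarrow> finite \<C> \<and> \<C> \<subseteq> sets M \<and> \<Union>\<C> \<subseteq> A \<and> (\<forall>C\<in>\<C>. measure M C \<le> \<delta>)" for \<C>
  define \<U> where "\<U> = Union ` Collect small"
  have empty: "{} \<in> \<U>"
    unfolding \<U>_def by (intro image_eqI[of _ _ "{}"]) (auto simp: small_def)
  have single: "C \<in> \<U>" if "C \<in> sets M" "C \<subseteq> A" "measure M C \<le> \<delta>" for C
    unfolding \<U>_def using that by (intro image_eqI[of _ _ "{C}"]) (auto simp: small_def)
  have un: "U \<union> V \<in> \<U>" if "U \<in> \<U>" "V \<in> \<U>" for U V
  proof -
    from that obtain \<C> \<D> where CD: "U = \<Union>\<C>" "V = \<Union>\<D>" "small \<C>" "small \<D>"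
      unfolding \<U>_def by (elim imageE) simp
    have "small (\<C> \<union> \<D>)"
      using CD(3,4) by (simp add: small_def ball_Un)
    moreover have "U \<union> V = \<Union>(\<C> \<union> \<D>)" using CD(1,2) by simp
    ultimately show ?thesis unfolding \<U>_def by (metis imageI mem_Collect_eq)
  qed
  have sub: "U \<subseteq> A" "U \<in> sets M" if "U \<in> \<U>" for U
  proof -
    from that obtain \<C> where C: "U = \<Union>\<C>" "small \<C>"
      unfolding \<U>_def by (elim imageE) simp
    then show "U \<subseteq> A" by (simp add: small_def)
    show "U \<in> sets M" unfolding C(1) using C(2) by (intro sets.finite_Union) (simp_all add: small_def)
  qed
  have fm: "U \<in> fmeasurable M" if "U \<in> \<U>" for U
    using sub[OF that] A by (meson fmeasurableI2)
  have le: "measure M U \<le> measure M A" if "U \<in> \<U>" for U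
    using sub[OF that] A by (intro measure_mono_fmeasurable)
  define s where "s = (SUP U\<in>\<U>. measure M U)"
  have bdd: "bdd_above (measure M ` \<U>)" using le by (auto intro!: bdd_aboveI)
  have upper: "measure M U \<le> s" if "U \<in> \<U>" for U
    unfolding s_def using bdd that by (rule cSUP_upper2) simp
  have "\<exists>U\<in>\<U>. s - 1 / real (Suc n) < measure M U" for n
    using less_cSUP_iff[OF _ bdd, of "s - 1 / real (Suc n)"] empty unfolding s_def[symmetric] by auto
  then obtain U where U: "\<And>n. U n \<in> \<U>" "\<And>n. s - 1 / real (Suc n) < measure M (U n)" by metis
  \<comment> \<open>Passing to partial unions makes the maximising sequence increasing, while
    closure under binary unions keeps it in \<open>\<U>\<close>.\<close>
  define W where "W n = (\<Union>i\<le>n. U i)" for n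
  have W: "W n \<in> \<U>" for n
  proof (induction n)
    case 0 show ?case using U by (simp add: W_def)
  next
    case (Suc n)
    have "W (Suc n) = W n \<union> U (Suc n)" by (auto simp: W_def atMost_Suc)
    then show ?case using un[OF Suc U(1)[of "Suc n"]] by simp
  qed
  define R where "R = (\<Inter>n. A - W n)"
  have Rs: "R \<in> sets M" unfolding R_def using A sub(2)[OF W] by auto
  have R0: "measure M R = 0"
  proof (rule ccontr)
    assume "measure M R \<noteq> 0"
    then have "0 < measure M R" by (simp add: less_le)
    from nonatomic_subset_le[OF na Rs this \<delta>] obtain C
      where C: "C \<in> sets M" "C \<subseteq> R" "0 < measure M C" "measure M C \<le> \<delta>" by blast
    have CA: "C \<subseteq> A" using C(2) by (auto simp: R_def)
    have CU: "C \<in> \<U>" using C CA by (intro single) auto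
    \<comment> \<open>\<open>U n \<union> C\<close> is again in \<open>\<U>\<close>, so its measure
      is at most \<open>s\<close>, whereas \<open>U n\<close> alone already comes within
      \<open>1 / real (Suc n)\<close> of \<open>s\<close>. Hence \<open>C\<close> would be
      null.\<close>
    have "measure M C \<le> 1 / real (Suc n)" for n
    proof -
      have "U n \<subseteq> W n" by (auto simp: W_def)
      then have disj: "U n \<inter> C = {}" using C(2) by (auto simp: R_def)
      have "measure M (U n \<union> C) = measure M (U n) + measure M C"
        using fm[OF U(1)[of n]] fm[OF CU] disj by (intro measure_Union) (auto simp: fmeasurable_def)
      with upper[OF un[OF U(1) CU], of n] U(2)[of n] show ?thesis by linarith
    qed
    moreover have "(\<lambda>n. 1 / real (Suc n)) \<longlonglongrightarrow> 0" by real_asymp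
    ultimately have "measure M C \<le> 0" by (intro LIMSEQ_le_const) auto
    with C(3) show False by simp
  qed
  \<comment> \<open>Continuity from above, available because \<open>A\<close> has finite
    measure.\<close>
  have "(\<lambda>n. measure M (A - W n)) \<longlonglongrightarrow> measure M R"
    unfolding R_def
  proof (rule Lim_measure_decseq)
    show "range (\<lambda>n. A - W n) \<subseteq> sets M" using A sub(2)[OF W] by auto
    show "decseq (\<lambda>n. A - W n)" unfolding decseq_def W_def by force
    show "emeasure M (A - W n) \<noteq> \<infinity>" for n
      using fmeasurable_Diff[OF A sub(2)[OF W, of n]] by (auto simp: fmeasurable_def)
  qed
  then have "eventually (\<lambda>n. measure M (A - W n) < \<delta>) sequentially"
    using \<delta> R0 by (intro order_tendstoD) auto
  then obtain n where n: "measure M (A - W n) < \<delta>" by (auto simp: eventually_sequentially)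
  have "A - W n \<in> \<U>" using n A sub(2)[OF W, of n] by (intro single) auto
  from un[OF W this] have "W n \<union> (A - W n) \<in> \<U>" .
  moreover have "W n \<union> (A - W n) = A" using sub(1)[OF W, of n] by auto
  ultimately show thesis using that unfolding \<U>_def by (auto simp: small_def)
qed

text \<open>For each level \<open>k\<close>, cover \<open>A\<close> by finitely many sets of measure
  at most \<open>1 / real (Suc k)\<close> and list all levels in one sequence. A point of
  \<open>A\<close> is met at every level, and each bound on the measure is violated only within
  finitely many levels.\<close>

lemma nonatomic_typewriter:
  assumes na: "nonatomic M" and A: "A \<in> fmeasurable M" "0 < measure M A"
  obtains E :: "nat \<Rightarrow> 'a set" where "\<And>n. E n \<in> sets M" "\<And>n. 0 < measure M (E n)"
    "(\<lambda>n. measure M (E n)) \<longlonglongrightarrow> 0" "\<And>x. x \<in> A \<Longrightarrow> infinite {n. x \<in> E n}"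
proof -
  have "\<exists>\<C>. finite \<C> \<and> \<C> \<subseteq> sets M \<and> A \<subseteq> \<Union>\<C> \<and>
      (\<forall>C\<in>\<C>. 0 < measure M C \<and> measure M C \<le> 1 / real (Suc k))" for k
  proof -
    have As: "A \<in> sets M" using A by auto
    have d: "0 < 1 / real (2 * Suc k)" by simp
    \<comment> \<open>The pieces of the cover may be null. Adjoining a fixed set \<open>B\<close> of
      positive measure to each of them repairs this, and the factor 2 leaves room for the sum of the
      two measures.\<close>
    obtain B where B: "B \<in> sets M" "B \<subseteq> A" "0 < measure M B" "measure M B \<le> 1 / real (2 * Suc k)"
      using nonatomic_subset_le[OF na As A(2) d] by blast
    obtain \<C> where \<C>: "finite \<C>" "\<C> \<subseteq> sets M" "\<Union>\<C> = A" "\<forall>C\<in>\<C>. measure M C \<le> 1 / real (2 * Suc k)"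
      using nonatomic_finite_cover_le[OF na A(1) d] by blast
    have "0 < measure M (C \<union> B) \<and> measure M (C \<union> B) \<le> 1 / real (Suc k)" if C: "C \<in> \<C>" for C
    proof -
      have CB: "C \<in> fmeasurable M" "B \<in> fmeasurable M"
        using C \<C>(2,3) A(1) B by (auto intro: fmeasurableI2)
      have "measure M B \<le> measure M (C \<union> B)"
        using CB by (intro measure_mono_fmeasurable) auto
      moreover have "measure M (C \<union> B) \<le> measure M C + measure M B"
        using CB by (intro measure_Un_le) auto
      moreover have "measure M C + measure M B \<le> 1 / real (2 * Suc k) + 1 / real (2 * Suc k)"
        using \<C>(4) B(4) C by (intro add_mono) auto
      moreover have "1 / real (2 * Suc k) + 1 / real (2 * Suc k) = 1 / real (Suc k)"
        by (simp add: field_simps)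
      ultimately show ?thesis using B(3) by (simp del: of_nat_Suc)
    qed
    then show ?thesis
      using \<C> B by (intro exI[of _ "(\<lambda>C. C \<union> B) ` \<C>"]) auto
  qed
  then obtain \<C> where \<C>: "\<And>k. finite (\<C> k)" "\<And>k. \<C> k \<subseteq> sets M" "\<And>k. A \<subseteq> \<Union>(\<C> k)"
    "\<And>k C. C \<in> \<C> k \<Longrightarrow> 0 < measure M C \<and> measure M C \<le> 1 / real (Suc k)"
    by metis
  \<comment> \<open>Sets are tagged with their level, so that projecting the pairs that contain
    \<open>x\<close> to the first component yields every level, hence infinitely many pairs.\<close>
  define I where "I = Sigma UNIV \<C>"
  have inf: "infinite {p \<in> I. x \<in> snd p}" if "x \<in> A" for x
  proof
    assume "finite {p \<in> I. x \<in> snd p}"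
    then have "finite (fst ` {p \<in> I. x \<in> snd p})" by (rule finite_imageI)
    moreover have "fst ` {p \<in> I. x \<in> snd p} = UNIV"
      using \<C>(3) that unfolding I_def by (force simp: image_iff)
    ultimately show False by simp
  qed
  have "A \<noteq> {}" using A(2) by auto
  then have "infinite I" using inf by (metis (no_types, lifting) ex_in_conv finite_subset mem_Collect_eq subsetI)
  moreover have "countable I" unfolding I_def using \<C>(1) by (intro countable_SIGMA) (auto simp: uncountable_infinite countable_finite)
  ultimately have bij: "bij_betw (from_nat_into I) UNIV I" by (rule bij_betw_from_nat_into[rotated])
  define e where "e = from_nat_into I"
  have e: "inj e" "range e = I" using bij by (auto simp: e_def bij_betw_def)
  define E where "E n = snd (e n)" for n
  have eI: "e n \<in> I" for n using e(2) by auto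
  have E1: "E n \<in> sets M" "0 < measure M (E n)" "measure M (E n) \<le> 1 / real (Suc (fst (e n)))" for n
  proof -
    have "snd (e n) \<in> \<C> (fst (e n))" using eI[of n] by (auto simp: I_def)
    with \<C>(2,4) show "E n \<in> sets M" "0 < measure M (E n)" "measure M (E n) \<le> 1 / real (Suc (fst (e n)))"
      unfolding E_def by blast+
  qed
  have lim: "(\<lambda>n. measure M (E n)) \<longlonglongrightarrow> 0"
  proof (rule order_tendstoI)
    fix a :: real assume "a < 0"
    then show "eventually (\<lambda>n. a < measure M (E n)) sequentially"
      by (intro always_eventually allI order_less_le_trans[OF _ measure_nonneg])
  next
    fix a :: real assume a: "0 < a"
    have "(\<lambda>k. 1 / real (Suc k)) \<longlonglongrightarrow> 0" by real_asymp
    then have "eventually (\<lambda>k. 1 / real (Suc k) < a) sequentially"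
      using a by (rule order_tendstoD)
    then obtain K where K: "\<And>k. k \<ge> K \<Longrightarrow> 1 / real (Suc k) < a" by (auto simp: eventually_sequentially)
    have "finite (Sigma {..<K} \<C>)" using \<C>(1) by auto
    then have "finite (e -` Sigma {..<K} \<C>)" using e(1) by (rule finite_vimageI)
    \<comment> \<open>Large sets occur only in the levels below \<open>K\<close>, which contain
      finitely many pairs; injectivity of \<open>e\<close> makes the set of their indices
      finite.\<close>
    moreover have "{n. \<not> measure M (E n) < a} \<subseteq> e -` Sigma {..<K} \<C>"
    proof
      fix n assume "n \<in> {n. \<not> measure M (E n) < a}"
      then have "\<not> 1 / real (Suc (fst (e n))) < a" using E1(3)[of n] by auto
      then have "fst (e n) < K" using K by (meson not_le)
      then show "n \<in> e -` Sigma {..<K} \<C>" using eI[of n] by (auto simp: I_def mem_Sigma_iff)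
    qed
    ultimately have "finite {n. \<not> measure M (E n) < a}" by (rule finite_subset[rotated])
    then show "eventually (\<lambda>n. measure M (E n) < a) sequentially"
      unfolding cofinite_eq_sequentially[symmetric] eventually_cofinite .
  qed
  have "infinite {n. x \<in> E n}" if "x \<in> A" for x
  proof
    assume "finite {n. x \<in> E n}"
    then have "finite (e ` {n. x \<in> E n})" by (rule finite_imageI)
    moreover have "e ` {n. x \<in> E n} = {p \<in> I. x \<in> snd p}"
      unfolding E_def e(2)[symmetric] by auto
    ultimately show False using inf[OF that] by simp
  qed
  with E1 lim that show thesis by blast
qed

lemma semifinite_obtain_fmeasurable:
  assumes "semifinite M" "emeasure M (space M) > 0"
  obtains A where "A \<in> fmeasurable M" "0 < measure M A"
proof -
  have "0 < (SUP B\<in>{B \<in> sets M. B \<subseteq> space M \<and> emeasure M B < \<infinity>}. emeasure M B)"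
    using assms unfolding semifinite_def by (metis sets.top)
  then obtain B where B: "B \<in> sets M" "emeasure M B < \<infinity>" "0 < emeasure M B"
    by (auto simp: less_SUP_iff)
  then have "B \<in> fmeasurable M" "0 < measure M B"
    by (auto simp: fmeasurable_def measure_def enn2real_positive_iff)
  with that show thesis .
qed

section \<open>Growth of polynomials in exponentials of powers\<close>

text \<open>The exponents are distinct, so there is a unique largest one, \<open>\<rho> j\<close>.
  After \<open>u powr \<rho> j\<close> is factored out, the cofactor tends to \<open>d j\<close>,
  whose sign decides between the two alternatives.\<close>

lemma sum_powr_tends_to_infinity:
  fixes d \<rho> :: "'i \<Rightarrow> real"
  assumes I: "finite I" "I \<noteq> {}" "inj_on \<rho> I" "\<And>i. i \<in> I \<Longrightarrow> 0 < \<rho> i" "\<And>i. i \<in> I \<Longrightarrow> d i \<noteq> 0"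
  shows "filterlim (\<lambda>u. \<Sum>i\<in>I. d i * u powr \<rho> i) at_top at_top \<or>
    filterlim (\<lambda>u. \<Sum>i\<in>I. d i * u powr \<rho> i) at_bot at_top"
proof -
  have "Max (\<rho> ` I) \<in> \<rho> ` I" using I(1,2) by simp
  then obtain j where j: "j \<in> I" "Max (\<rho> ` I) = \<rho> j" by (elim imageE)
  have less: "\<rho> i < \<rho> j" if "i \<in> I - {j}" for i
  proof -
    have "\<rho> i \<le> \<rho> j" using Max_ge[of "\<rho> ` I" "\<rho> i"] I(1) j(2) that by simp
    moreover have "\<rho> i \<noteq> \<rho> j" using that j(1) I(3) by (auto dest: inj_onD)
    ultimately show ?thesis by simp
  qed
  have t: "((\<lambda>u. d i * u powr (\<rho> i - \<rho> j)) \<longlongrightarrow> 0) at_top" if "i \<in> I - {j}" for i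
    using less[OF that] by (intro tendsto_mult_right_zero tendsto_neg_powr filterlim_ident) auto
  have "((\<lambda>u. d j + (\<Sum>i\<in>I-{j}. d i * u powr (\<rho> i - \<rho> j))) \<longlongrightarrow> d j + (\<Sum>i\<in>I-{j}. 0)) at_top"
    by (intro tendsto_add tendsto_const tendsto_sum t)
  then have lim: "((\<lambda>u. d j + (\<Sum>i\<in>I-{j}. d i * u powr (\<rho> i - \<rho> j))) \<longlongrightarrow> d j) at_top" by simp
  have inf: "filterlim (\<lambda>u::real. u powr \<rho> j) at_top at_top"
    using I(4)[OF j(1)] by real_asymp
  have eq: "eventually (\<lambda>u. (d j + (\<Sum>i\<in>I-{j}. d i * u powr (\<rho> i - \<rho> j))) * u powr \<rho> j =
      (\<Sum>i\<in>I. d i * u powr \<rho> i)) at_top"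
    using eventually_gt_at_top[of 0]
  proof eventually_elim
    case (elim u)
    show ?case
      unfolding sum.remove[OF I(1) j(1)] using elim
      by (simp add: distrib_right sum_distrib_right powr_diff mult.assoc)
  qed
  consider "d j > 0" | "d j < 0" using I(5)[OF j(1)] by linarith
  then show ?thesis
  proof cases
    case 1
    from filterlim_tendsto_pos_mult_at_top[OF lim 1 inf] show ?thesis
      unfolding filterlim_cong[OF refl refl eq] by simp
  next
    case 2
    from filterlim_tendsto_neg_mult_at_bot[OF lim 2 inf] show ?thesis
      unfolding filterlim_cong[OF refl refl eq] by simp
  qed
qed

text \<open>Divergence of the difference to infinity is a transitive relation, since two such
  differences add up. As any two members of the finite set are comparable, there is a greatest
  one.\<close>

lemma exists_dominant:
  fixes h :: "'m \<Rightarrow> 'u \<Rightarrow> real"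
  assumes "finite K" "K \<noteq> {}"
    and "\<And>m m'. m \<in> K \<Longrightarrow> m' \<in> K \<Longrightarrow> m \<noteq> m' \<Longrightarrow>
      filterlim (\<lambda>u. h m u - h m' u) at_top F \<or> filterlim (\<lambda>u. h m' u - h m u) at_top F"
  shows "\<exists>k\<in>K. \<forall>m\<in>K - {k}. filterlim (\<lambda>u. h k u - h m u) at_top F"
  using assms
proof (induction K rule: finite_ne_induct)
  case (singleton x)
  then show ?case by auto
next
  case (insert x K)
  then obtain k where k: "k \<in> K" "\<And>m. m \<in> K - {k} \<Longrightarrow> filterlim (\<lambda>u. h k u - h m u) at_top F"
    by (metis insertCI)
  have "x \<noteq> k" using insert.hyps k by auto
  with insert.prems[of x k] k(1) consider "filterlim (\<lambda>u. h x u - h k u) at_top F"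
    | "filterlim (\<lambda>u. h k u - h x u) at_top F" by auto
  then show ?case
  proof cases
    case 1
    have "filterlim (\<lambda>u. h x u - h m u) at_top F" if "m \<in> K" for m
    proof (cases "m = k")
      case False
      have "filterlim (\<lambda>u. (h x u - h k u) + (h k u - h m u)) at_top F"
        using 1 k(2)[of m] that False by (intro filterlim_at_top_add_at_top) auto
      then show ?thesis by simp
    qed (use 1 in simp)
    then show ?thesis by (intro bexI[of _ x]) auto
  next
    case 2
    then show ?thesis using k by (intro bexI[of _ k]) auto
  qed
qed

text \<open>With \<open>exp (h k u)\<close> factored out, all other terms decay and the cofactor
  tends to \<open>a k\<close>; eventually its absolute value exceeds half of
  \<open>\<bar>a k\<bar>\<close>.\<close>

lemma exp_sum_lower_bound:
  fixes h :: "'m \<Rightarrow> 'u \<Rightarrow> real" and a :: "'m \<Rightarrow> real"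
  assumes K: "finite K" "k \<in> K" "a k \<noteq> 0"
    and dom: "\<forall>m\<in>K - {k}. filterlim (\<lambda>u. h k u - h m u) at_top F"
  shows "eventually (\<lambda>u. \<bar>a k\<bar> / 2 * exp (h k u) \<le> \<bar>\<Sum>m\<in>K. a m * exp (h m u)\<bar>) F"
proof -
  have t: "((\<lambda>u. a m * exp (- (h k u - h m u))) \<longlongrightarrow> 0) F" if "m \<in> K - {k}" for m
    using dom that
    by (intro tendsto_mult_right_zero filterlim_compose[OF exp_at_bot]
        filterlim_compose[OF filterlim_uminus_at_bot_at_top]) auto
  have "((\<lambda>u. \<bar>a k + (\<Sum>m\<in>K-{k}. a m * exp (- (h k u - h m u)))\<bar>) \<longlongrightarrow> \<bar>a k + (\<Sum>m\<in>K-{k}. 0)\<bar>) F"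
    by (intro tendsto_rabs tendsto_add tendsto_const tendsto_sum t)
  then have "eventually (\<lambda>u. \<bar>a k\<bar> / 2 < \<bar>a k + (\<Sum>m\<in>K-{k}. a m * exp (- (h k u - h m u)))\<bar>) F"
    by (rule order_tendstoD) (use K in auto)
  then show ?thesis
  proof eventually_elim
    case (elim u)
    have "(\<Sum>m\<in>K. a m * exp (h m u)) =
        (a k + (\<Sum>m\<in>K-{k}. a m * exp (- (h k u - h m u)))) * exp (h k u)"
      unfolding sum.remove[OF K(1,2)]
      by (simp add: distrib_right sum_distrib_right mult.assoc exp_add[symmetric])
    then show ?case using elim by (simp add: abs_mult)
  qed
qed

text \<open>Each monomial becomes the exponential of a sum of powers of \<open>u\<close>, so the
  comparison of monomials reduces to such sums. The dominant monomial is not constant; any variable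
  \<open>j\<close> in it supplies \<open>s = \<rho> j\<close>, and half the absolute value of its
  coefficient supplies \<open>c\<close>.\<close>

lemma mpoly_exp_powr_lower_bound:
  fixes P :: real_mpoly and \<rho> :: "nat \<Rightarrow> real"
  assumes P: "P \<noteq> 0" "mpoly_in_vars N P" "Poly_Mapping.lookup P 0 = 0"
    and \<rho>: "inj_on \<rho> {..<N}" "\<And>i. i < N \<Longrightarrow> 0 < \<rho> i"
  obtains c s where "0 < c" "0 < s"
    "eventually (\<lambda>u. c * exp (u powr s) \<le> \<bar>\<Sum>m\<in>Poly_Mapping.keys P. Poly_Mapping.lookup P m *
       (\<Prod>i\<in>Poly_Mapping.keys m. exp (u powr \<rho> i) ^ Poly_Mapping.lookup m i)\<bar>) at_top"
proof -
  let ?K = "Poly_Mapping.keys P"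
  \<comment> \<open>Summing over all \<open>i < N\<close> rather than over the keys of
    \<open>m\<close> lets the exponents of two monomials be subtracted term by term; the additional
    terms are 0.\<close>
  define h where "h m u = (\<Sum>i<N. real (Poly_Mapping.lookup m i) * u powr \<rho> i)"
    for m :: "nat \<Rightarrow>\<^sub>0 nat" and u :: real
  have km: "Poly_Mapping.keys m \<subseteq> {..<N}" if "m \<in> ?K" for m
    using P(2) that by (auto simp: mpoly_in_vars_def)
  have prod: "(\<Prod>i\<in>Poly_Mapping.keys m. exp (u powr \<rho> i) ^ Poly_Mapping.lookup m i) = exp (h m u)"
    if "m \<in> ?K" for m u
  proof -
    have "h m u = (\<Sum>i\<in>Poly_Mapping.keys m. real (Poly_Mapping.lookup m i) * u powr \<rho> i)"
      unfolding h_def using km[OF that] by (intro sum.mono_neutral_right) (auto simp: in_keys_iff)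
    then show ?thesis by (simp add: exp_sum exp_of_nat_mult)
  qed
  have cmp: "filterlim (\<lambda>u. h m u - h m' u) at_top at_top \<or> filterlim (\<lambda>u. h m' u - h m u) at_top at_top"
    if m: "m \<in> ?K" "m' \<in> ?K" "m \<noteq> m'" for m m'
  proof -
    define d where "d i = real (Poly_Mapping.lookup m i) - real (Poly_Mapping.lookup m' i)" for i
    define I where "I = {i. i < N \<and> d i \<noteq> 0}"
    have diff: "h m u - h m' u = (\<Sum>i\<in>I. d i * u powr \<rho> i)" for u
    proof -
      have "h m u - h m' u = (\<Sum>i<N. d i * u powr \<rho> i)"
        unfolding h_def d_def by (simp add: sum_subtractf left_diff_distrib)
      also have "\<dots> = (\<Sum>i\<in>I. d i * u powr \<rho> i)"
        unfolding I_def by (intro sum.mono_neutral_right) auto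
      finally show ?thesis .
    qed
    \<comment> \<open>Beyond \<open>N\<close> both monomials have exponent 0, so distinct monomials
      must differ in some variable below \<open>N\<close>.\<close>
    have "I \<noteq> {}"
    proof
      assume "I = {}"
      then have "Poly_Mapping.lookup m i = Poly_Mapping.lookup m' i" if "i < N" for i
        using that by (auto simp: I_def d_def)
      moreover have "Poly_Mapping.lookup m i = Poly_Mapping.lookup m' i" if "\<not> i < N" for i
      proof -
        have "i \<notin> Poly_Mapping.keys m" "i \<notin> Poly_Mapping.keys m'" using km m that by auto
        then show ?thesis by (simp add: in_keys_iff)
      qed
      ultimately have "m = m'" by (intro poly_mapping_eqI) blast
      with m show False by simp
    qed
    then have "filterlim (\<lambda>u. \<Sum>i\<in>I. d i * u powr \<rho> i) at_top at_top \<or>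
        filterlim (\<lambda>u. \<Sum>i\<in>I. d i * u powr \<rho> i) at_bot at_top"
      using \<rho> by (intro sum_powr_tends_to_infinity) (auto simp: I_def inj_on_def)
    then show ?thesis
      unfolding diff[symmetric] by (auto simp: filterlim_uminus_at_bot)
  qed
  have "?K \<noteq> {}" using P(1) by simp
  then have "\<exists>k\<in>?K. \<forall>m\<in>?K - {k}. filterlim (\<lambda>u. h k u - h m u) at_top at_top"
    by (intro exists_dominant cmp finite_keys)
  then obtain k where k: "k \<in> ?K" "\<forall>m\<in>?K - {k}. filterlim (\<lambda>u. h k u - h m u) at_top at_top"
    by (elim bexE)
  have ak: "Poly_Mapping.lookup P k \<noteq> 0" using k(1) by (simp add: in_keys_iff)
  \<comment> \<open>The vanishing constant coefficient enters here: without it the constant monomial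
    could be the dominant one and there would be no growth.\<close>
  then have "k \<noteq> 0" using P(3) by auto
  then obtain j where j: "j \<in> Poly_Mapping.keys k" by (metis keys_eq_empty ex_in_conv)
  then have jN: "j < N" using km[OF k(1)] by auto
  have "u powr \<rho> j \<le> h k u" for u
  proof -
    have "1 * u powr \<rho> j \<le> real (Poly_Mapping.lookup k j) * u powr \<rho> j"
      using j by (intro mult_right_mono) (auto simp: in_keys_iff)
    also have "\<dots> \<le> h k u"
      unfolding h_def using jN by (intro member_le_sum) auto
    finally show ?thesis by simp
  qed
  then have "\<bar>Poly_Mapping.lookup P k\<bar> / 2 * exp (u powr \<rho> j) \<le> \<bar>Poly_Mapping.lookup P k\<bar> / 2 * exp (h k u)" for u
    by (intro mult_left_mono) auto
  moreover have "eventually (\<lambda>u. \<bar>Poly_Mapping.lookup P k\<bar> / 2 * exp (h k u) \<le>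
      \<bar>\<Sum>m\<in>?K. Poly_Mapping.lookup P m * exp (h m u)\<bar>) at_top"
    using finite_keys k(1) ak k(2) by (rule exp_sum_lower_bound)
  ultimately have "eventually (\<lambda>u. \<bar>Poly_Mapping.lookup P k\<bar> / 2 * exp (u powr \<rho> j) \<le>
      \<bar>\<Sum>m\<in>?K. Poly_Mapping.lookup P m * exp (h m u)\<bar>) at_top"
    by (auto elim!: eventually_mono intro: order_trans)
  with that[of "\<bar>Poly_Mapping.lookup P k\<bar> / 2" "\<rho> j"] ak \<rho>(2)[OF jN] show thesis
    by (simp add: prod)
qed

section \<open>Evaluation of polynomials on representatives\<close>

lemma L0_seq_pow_class:
  assumes "\<And>n. f n \<in> borel_measurable M"
  shows "(\<lambda>n. ae_class M (f n)) [^]\<^bsub>L0_seq M\<^esub> (k::nat) = (\<lambda>n. ae_class M (\<lambda>x. f n x ^ k))"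
proof (induction k)
  case 0
  then show ?case by (simp add: nat_pow_def L0_seq_def)
next
  case (Suc k)
  interpret cring "L0_seq M" by (rule cring_L0_seq)
  from Suc show ?case
    using assms by (simp add: nat_pow_Suc) (simp add: L0_seq_simps mult.commute)
qed

lemma L0_seq_finprod_class:
  assumes "finite I" "\<And>i n. i \<in> I \<Longrightarrow> f i n \<in> borel_measurable M"
  shows "(\<Otimes>\<^bsub>L0_seq M\<^esub>i\<in>I. (\<lambda>n. ae_class M (f i n))) = (\<lambda>n. ae_class M (\<lambda>x. \<Prod>i\<in>I. f i n x))"
  using assms
proof (induction I rule: finite_induct)
  interpret cring "L0_seq M" by (rule cring_L0_seq)
  case empty
  show ?case by simp (simp add: L0_seq_def)
next
  interpret cring "L0_seq M" by (rule cring_L0_seq)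
  case (insert j I)
  have "(\<Otimes>\<^bsub>L0_seq M\<^esub>i\<in>insert j I. (\<lambda>n. ae_class M (f i n))) =
      (\<lambda>n. ae_class M (f j n)) \<otimes>\<^bsub>L0_seq M\<^esub> (\<lambda>n. ae_class M (\<lambda>x. \<Prod>i\<in>I. f i n x))"
    using insert by (subst finprod_insert) (auto intro!: ae_class_seq_in_carrier)
  then show ?case using insert by (simp add: L0_seq_simps)
qed

lemma L0_seq_finsum_class:
  assumes "finite I" "\<And>i n. i \<in> I \<Longrightarrow> f i n \<in> borel_measurable M"
  shows "(\<Oplus>\<^bsub>L0_seq M\<^esub>i\<in>I. (\<lambda>n. ae_class M (f i n))) = (\<lambda>n. ae_class M (\<lambda>x. \<Sum>i\<in>I. f i n x))"
  using assms
proof (induction I rule: finite_induct)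
  interpret cring "L0_seq M" by (rule cring_L0_seq)
  case empty
  show ?case by simp (simp add: L0_seq_def)
next
  interpret cring "L0_seq M" by (rule cring_L0_seq)
  case (insert j I)
  have "(\<Oplus>\<^bsub>L0_seq M\<^esub>i\<in>insert j I. (\<lambda>n. ae_class M (f i n))) =
      (\<lambda>n. ae_class M (f j n)) \<oplus>\<^bsub>L0_seq M\<^esub> (\<lambda>n. ae_class M (\<lambda>x. \<Sum>i\<in>I. f i n x))"
    using insert by (subst finsum_insert) (auto intro!: ae_class_seq_in_carrier)
  then show ?case using insert by (simp add: L0_seq_simps)
qed

text \<open>Reduces the algebra of classes to pointwise computation with real functions.
  Representatives are needed only for \<open>i < N\<close>, because \<open>mpoly_in_vars\<close>
  confines the monomials to these variables.\<close>

lemma poly_eval_L0_seq_class: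
  assumes P: "mpoly_in_vars N P"
    and f: "\<And>i n. i < N \<Longrightarrow> f i n \<in> borel_measurable M"
    and x: "\<And>i. i < N \<Longrightarrow> x i = (\<lambda>n. ae_class M (f i n))"
  shows "poly_eval (L0_seq M) P x = (\<lambda>n. ae_class M (\<lambda>\<omega>. \<Sum>m\<in>Poly_Mapping.keys P.
    Poly_Mapping.lookup P m * (\<Prod>i\<in>Poly_Mapping.keys m. f i n \<omega> ^ Poly_Mapping.lookup m i)))"
proof -
  interpret cring "L0_seq M" by (rule cring_L0_seq)
  have lt: "i < N" if "m \<in> Poly_Mapping.keys P" "i \<in> Poly_Mapping.keys m" for m i
    using P that by (auto simp: mpoly_in_vars_def)
  have meas: "(\<lambda>\<omega>. \<Prod>i\<in>Poly_Mapping.keys m. f i n \<omega> ^ Poly_Mapping.lookup m i) \<in> borel_measurable M"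
    if "m \<in> Poly_Mapping.keys P" for m n
    using f lt[OF that] by (intro borel_measurable_prod borel_measurable_power) auto
  have term_class: "Poly_Mapping.lookup P m \<odot>\<^bsub>L0_seq M\<^esub>
      (\<Otimes>\<^bsub>L0_seq M\<^esub>i\<in>Poly_Mapping.keys m. x i [^]\<^bsub>L0_seq M\<^esub> Poly_Mapping.lookup m i) =
    (\<lambda>n. ae_class M (\<lambda>\<omega>. Poly_Mapping.lookup P m *
      (\<Prod>i\<in>Poly_Mapping.keys m. f i n \<omega> ^ Poly_Mapping.lookup m i)))"
    if m: "m \<in> Poly_Mapping.keys P" for m
  proof -
    have "(\<Otimes>\<^bsub>L0_seq M\<^esub>i\<in>Poly_Mapping.keys m. x i [^]\<^bsub>L0_seq M\<^esub> Poly_Mapping.lookup m i) =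
      (\<Otimes>\<^bsub>L0_seq M\<^esub>i\<in>Poly_Mapping.keys m. (\<lambda>n. ae_class M (\<lambda>\<omega>. f i n \<omega> ^ Poly_Mapping.lookup m i)))"
      using f lt[OF m] by (intro finprod_cong') (auto simp: x L0_seq_pow_class intro!: ae_class_seq_in_carrier)
    also have "\<dots> = (\<lambda>n. ae_class M (\<lambda>\<omega>. \<Prod>i\<in>Poly_Mapping.keys m. f i n \<omega> ^ Poly_Mapping.lookup m i))"
      using f lt[OF m] by (intro L0_seq_finprod_class) auto
    finally show ?thesis
      using meas[OF m] by (simp add: L0_seq_def L0_smult_class)
  qed
  have "poly_eval (L0_seq M) P x = (\<Oplus>\<^bsub>L0_seq M\<^esub>m\<in>Poly_Mapping.keys P. (\<lambda>n. ae_class M (\<lambda>\<omega>.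
      Poly_Mapping.lookup P m * (\<Prod>i\<in>Poly_Mapping.keys m. f i n \<omega> ^ Poly_Mapping.lookup m i))))"
    unfolding poly_eval_def
    using meas by (intro finsum_cong') (auto simp: term_class intro!: ae_class_seq_in_carrier)
  also have "\<dots> = (\<lambda>n. ae_class M (\<lambda>\<omega>. \<Sum>m\<in>Poly_Mapping.keys P.
    Poly_Mapping.lookup P m * (\<Prod>i\<in>Poly_Mapping.keys m. f i n \<omega> ^ Poly_Mapping.lookup m i)))"
    using meas by (intro L0_seq_finsum_class) auto
  finally show ?thesis .
qed

section \<open>Convergence of scaled indicator sequences\<close>

text \<open>However large \<open>a n\<close> is, the function exceeds \<open>\<epsilon>\<close> in
  absolute value only inside \<open>E n\<close>.\<close>

lemma indicator_seq_in_S_m: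
  assumes E: "\<And>n. E n \<in> sets M" "\<And>n. 0 < measure M (E n)" "(\<lambda>n. measure M (E n)) \<longlonglongrightarrow> 0"
  shows "(\<lambda>n. ae_class M (\<lambda>\<omega>. a n * indicator (E n) \<omega>)) \<in> S_m M"
proof -
  have em: "emeasure M (E n) = ennreal (measure M (E n))" for n
    using E(2)[of n] by (intro emeasure_eq_ennreal_measure) (auto simp: measure_def)
  have lim: "(\<lambda>n. emeasure M (E n)) \<longlonglongrightarrow> 0"
    unfolding em using tendsto_ennrealI[OF E(3)] by simp
  have [measurable]: "E n \<in> sets M" for n by (rule E)
  show ?thesis
  proof (subst S_m_iff, measurable, intro allI impI)
    fix \<epsilon> :: real assume "0 < \<epsilon>"
    have le: "emeasure M {x \<in> space M. \<epsilon> < \<bar>a n * indicator (E n) x\<bar>} \<le> emeasure M (E n)" for n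
      using \<open>0 < \<epsilon>\<close> by (intro emeasure_mono E) (auto simp: indicator_def split: if_splits)
    show "(\<lambda>n. emeasure M {x \<in> space M. \<epsilon> < \<bar>a n * indicator (E n) x\<bar>}) \<longlonglongrightarrow> 0"
      by (rule tendsto_sandwich[OF _ _ tendsto_const lim]) (auto intro: always_eventually le)
  qed
qed

text \<open>At a point of \<open>A\<close> the absolute value is at least \<open>c\<close> for
  infinitely many \<open>n\<close>, so convergence to 0 fails on all of \<open>A\<close>, which is
  not null.\<close>

lemma indicator_seq_notin_S_p:
  assumes E: "\<And>n. E n \<in> sets M"
    and A: "A \<in> sets M" "0 < measure M A" "\<And>x. x \<in> A \<Longrightarrow> infinite {n. x \<in> E n}"
    and c: "0 < c" "eventually (\<lambda>n. c \<le> \<bar>a n\<bar>) sequentially"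
  shows "(\<lambda>n. ae_class M (\<lambda>\<omega>. a n * indicator (E n) \<omega>)) \<notin> S_p M"
proof
  have [measurable]: "E n \<in> sets M" for n by (rule E)
  assume "(\<lambda>n. ae_class M (\<lambda>\<omega>. a n * indicator (E n) \<omega>)) \<in> S_p M"
  then have "AE x in M. (\<lambda>n. a n * indicator (E n) x) \<longlonglongrightarrow> 0"
    by (subst (asm) S_p_iff) measurable
  moreover have "\<not> (\<lambda>n. a n * indicator (E n) x) \<longlonglongrightarrow> 0" if "x \<in> A" for x
  proof
    assume "(\<lambda>n. a n * indicator (E n) x) \<longlonglongrightarrow> 0"
    then have "eventually (\<lambda>n. \<bar>a n * indicator (E n) x\<bar> < c) sequentially"
      using c(1) by (intro order_tendstoD[OF tendsto_rabs_zero])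
    with c(2) have "eventually (\<lambda>n. x \<notin> E n) sequentially"
      by eventually_elim (auto simp: indicator_def)
    then have "finite {n. x \<in> E n}"
      unfolding cofinite_eq_sequentially[symmetric] eventually_cofinite by simp
    with A(3)[OF that] show False by simp
  qed
  ultimately have "AE x in M. x \<notin> A" by (auto elim!: eventually_mono)
  then have "emeasure M A = 0" using A(1) by (simp add: AE_iff_null_sets null_setsD1)
  with A(2) show False by (simp add: measure_def)
qed

text \<open>The integral of the \<open>q\<close>-th power equals
  \<open>\<bar>a n\<bar> powr q * measure M (E n)\<close>, which diverges by assumption.\<close>

lemma indicator_seq_notin_S_L:
  assumes E: "\<And>n. E n \<in> sets M" "\<And>n. 0 < measure M (E n)"
    and q: "0 < q"
    and a: "filterlim (\<lambda>n. \<bar>a n\<bar> powr q * measure M (E n)) at_top sequentially"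
  shows "(\<lambda>n. ae_class M (\<lambda>\<omega>. a n * indicator (E n) \<omega>)) \<notin> S_L q M"
proof
  have [measurable]: "E n \<in> sets M" for n by (rule E)
  have em: "emeasure M (E n) = ennreal (measure M (E n))" for n
    using E(2)[of n] by (intro emeasure_eq_ennreal_measure) (auto simp: measure_def)
  have int: "(\<integral>\<^sup>+ x. ennreal (\<bar>a n * indicator (E n) x\<bar> powr q) \<partial>M) =
      ennreal (\<bar>a n\<bar> powr q * measure M (E n))" for n
  proof -
    have "(\<integral>\<^sup>+ x. ennreal (\<bar>a n * indicator (E n) x\<bar> powr q) \<partial>M) =
        (\<integral>\<^sup>+ x. ennreal (\<bar>a n\<bar> powr q) * indicator (E n) x \<partial>M)"
      using q by (intro nn_integral_cong) (auto simp: indicator_def)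
    then show ?thesis by (simp add: nn_integral_cmult_indicator em ennreal_mult)
  qed
  assume "(\<lambda>n. ae_class M (\<lambda>\<omega>. a n * indicator (E n) \<omega>)) \<in> S_L q M"
  then have "(\<lambda>n. \<integral>\<^sup>+ x. ennreal (\<bar>a n * indicator (E n) x\<bar> powr q) \<partial>M) \<longlonglongrightarrow> 0"
    by (subst (asm) S_L_iff) measurable
  then have "(\<lambda>n. \<bar>a n\<bar> powr q * measure M (E n)) \<longlonglongrightarrow> 0"
    unfolding int by (subst (asm) tendsto_ennreal_iff[of _ _ 0, simplified]) auto
  with a show False
    using not_tendsto_and_filterlim_at_infinity[OF sequentially_bot _ filterlim_at_top_imp_at_infinity] by blast
qed

section \<open>Exponential generators on the typewriter sequence\<close>

theorem theorem4p2:
  fixes M :: "'a measure"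
  assumes "emeasure M (space M) > 0"
    and "nonatomic M"
    and "semifinite M"
  shows "strongly_continuum_algebrable (L0_seq M) (S_m M - (S_p M \<union> (\<Union>q\<in>{0<..}. S_L q M)))"
proof -
  obtain A where A: "A \<in> fmeasurable M" "0 < measure M A"
    using semifinite_obtain_fmeasurable assms by blast
  obtain E :: "nat \<Rightarrow> 'a set" where E: "\<And>n. E n \<in> sets M" "\<And>n. 0 < measure M (E n)"
    "(\<lambda>n. measure M (E n)) \<longlonglongrightarrow> 0" "\<And>x. x \<in> A \<Longrightarrow> infinite {n. x \<in> E n}"
    using nonatomic_typewriter[OF assms(2) A] by blast
  have [measurable]: "E n \<in> sets M" for n by (rule E)
  define u where "u n = 1 / measure M (E n)" for n
  have u: "filterlim u at_top sequentially"
    unfolding u_def inverse_eq_divide[symmetric] using E(2,3)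
    by (intro filterlim_compose[OF filterlim_inverse_at_top_right])
       (auto simp: filterlim_at less_imp_neq[symmetric] intro!: always_eventually)
  have mu: "measure M (E n) = 1 / u n" for n by (simp add: u_def)
  \<comment> \<open>The exponent \<open>exp r\<close> is positive and injective in \<open>r\<close>,
    so all of the reals can index the generators.\<close>
  define g where "g r n \<omega> = exp (u n powr exp r) * indicator (E n) \<omega>" for r n \<omega>
  have gm [measurable]: "g r n \<in> borel_measurable M" for r n
    unfolding g_def by measurable
  define G where "G r = (\<lambda>n. ae_class M (g r n))" for r
  have "inj G"
  proof (rule injI)
    fix r s assume "G r = G s"
    \<comment> \<open>For a base above 1, \<open>powr\<close> is injective in the exponent. One such
      \<open>n\<close> suffices: \<open>E n\<close> is not null, so equal classes force equal values
      at some point of it.\<close>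
    have "eventually (\<lambda>n. 1 < u n) sequentially"
      using u by (simp add: filterlim_at_top_dense)
    then obtain n where n: "1 < u n" by (auto simp: eventually_sequentially)
    have "ae_class M (g r n) = ae_class M (g s n)"
      using \<open>G r = G s\<close> by (simp add: G_def fun_eq_iff)
    then have ae: "AE x in M. g r n x = g s n x"
      by (simp add: ae_class_eq_iff)
    have "\<exists>x\<in>E n. g r n x = g s n x"
    proof (rule ccontr)
      assume "\<not> ?thesis"
      with ae have "AE x in M. x \<notin> E n" by (auto elim!: eventually_mono)
      then have "emeasure M (E n) = 0" by (simp add: AE_iff_null_sets null_setsD1)
      with E(2)[of n] show False by (simp add: measure_def)
    qed
    then show "r = s" using n by (auto simp: g_def powr_inj)
  qed
  then have "range G \<approx> (UNIV :: real set)" by (rule inj_on_image_eqpoll_self)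
  moreover have "range G \<subseteq> carrier (L0_seq M)"
    by (auto simp: G_def intro!: ae_class_seq_in_carrier)
  moreover have "poly_eval (L0_seq M) P x \<in>
      S_m M - (S_p M \<union> (\<Union>q\<in>{0<..}. S_L q M)) - {\<zero>\<^bsub>L0_seq M\<^esub>}"
    if P: "P \<noteq> 0" "mpoly_in_vars N P" "Poly_Mapping.lookup P 0 = 0"
      and x: "inj_on x {..<N}" "x ` {..<N} \<subseteq> range G" for N P x
  proof -
    have "\<forall>i\<in>{..<N}. \<exists>r. x i = G r" using x(2) by blast
    then obtain r where r: "\<And>i. i < N \<Longrightarrow> x i = G (r i)" by (metis lessThan_iff)
    have inj: "inj_on (\<lambda>i. exp (r i)) {..<N}"
      using x(1) r by (auto simp: inj_on_def)
    define p where "p v = (\<Sum>m\<in>Poly_Mapping.keys P. Poly_Mapping.lookup P m *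
       (\<Prod>i\<in>Poly_Mapping.keys m. exp (v powr exp (r i)) ^ Poly_Mapping.lookup m i))" for v
    obtain c s where cs: "0 < c" "0 < s" "eventually (\<lambda>v. c * exp (v powr s) \<le> \<bar>p v\<bar>) at_top"
      using mpoly_exp_powr_lower_bound[OF P inj] unfolding p_def by auto
    have ev: "eventually (\<lambda>n. c * exp (u n powr s) \<le> \<bar>p (u n)\<bar>) sequentially"
      using cs(3) u by (rule eventually_compose_filterlim)
    have val: "(\<Sum>m\<in>Poly_Mapping.keys P. Poly_Mapping.lookup P m *
        (\<Prod>i\<in>Poly_Mapping.keys m. g (r i) n \<omega> ^ Poly_Mapping.lookup m i)) =
        p (u n) * indicator (E n) \<omega>" for n \<omega>
    proof (cases "\<omega> \<in> E n")
      case True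
      then show ?thesis by (simp add: g_def p_def)
    next
      case False
      \<comment> \<open>There is no constant monomial, so each product contains a positive power of
        some generator, and every generator vanishes off \<open>E n\<close>. The whole polynomial is
        thus again a scaled indicator of \<open>E n\<close>.\<close>
      have zero: "(\<Prod>i\<in>Poly_Mapping.keys m. g (r i) n \<omega> ^ Poly_Mapping.lookup m i) = 0"
        if "m \<in> Poly_Mapping.keys P" for m
      proof -
        have "m \<noteq> 0" using that P(3) by (auto simp: in_keys_iff)
        then obtain j where "j \<in> Poly_Mapping.keys m" by (metis keys_eq_empty ex_in_conv)
        then show ?thesis
          using False by (intro prod_zero) (auto simp: g_def in_keys_iff intro!: bexI[of _ j])
      qed
      have "(\<Sum>m\<in>Poly_Mapping.keys P. Poly_Mapping.lookup P m *
        (\<Prod>i\<in>Poly_Mapping.keys m. g (r i) n \<omega> ^ Poly_Mapping.lookup m i)) = 0"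
        using zero by (intro sum.neutral ballI) (simp only: mult_zero_right)
      then show ?thesis using False by simp
    qed
    have eval: "poly_eval (L0_seq M) P x = (\<lambda>n. ae_class M (\<lambda>\<omega>. p (u n) * indicator (E n) \<omega>))"
      using poly_eval_L0_seq_class[OF P(2), of "\<lambda>i. g (r i)" M x] r by (simp add: G_def val)
    have "c \<le> c * exp (u n powr s)" for n
      using cs(1) by simp
    with ev have "eventually (\<lambda>n. c \<le> \<bar>p (u n)\<bar>) sequentially"
      by (auto elim!: eventually_mono intro: order_trans)
    then have notp: "poly_eval (L0_seq M) P x \<notin> S_p M"
      unfolding eval using A E cs(1) by (intro indicator_seq_notin_S_p) auto
    have "poly_eval (L0_seq M) P x \<notin> S_L q M" if q: "0 < q" for q
      unfolding eval
    proof (intro indicator_seq_notin_S_L E q)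
      \<comment> \<open>With \<open>v = u n\<close> the factor \<open>1 / v\<close> is the measure
        of \<open>E n\<close>; the exponential of a positive power of \<open>v\<close> outgrows
        \<open>v\<close> for every \<open>q > 0\<close>.\<close>
      have "filterlim (\<lambda>v. (c * exp (v powr s)) powr q * (1 / v)) at_top at_top"
        using cs(1,2) q by real_asymp
      from filterlim_compose[OF this u]
      show "filterlim (\<lambda>n. \<bar>p (u n)\<bar> powr q * measure M (E n)) at_top sequentially"
      proof (rule filterlim_at_top_mono)
        show "eventually (\<lambda>n. (c * exp (u n powr s)) powr q * (1 / u n) \<le>
            \<bar>p (u n)\<bar> powr q * measure M (E n)) sequentially"
          using ev
        proof eventually_elim
          case (elim n)
          then show ?case
            unfolding mu[symmetric] using cs(1) q by (intro mult_right_mono powr_mono2) auto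
        qed
      qed
    qed
    moreover have "poly_eval (L0_seq M) P x \<in> S_m M"
      unfolding eval by (intro indicator_seq_in_S_m E)
    \<comment> \<open>Since zero converges pointwise, being outside \<open>S_p M\<close> already
      makes the value nonzero.\<close>
    moreover have "\<zero>\<^bsub>L0_seq M\<^esub> \<in> S_p M"
      using S_p_iff[of "\<lambda>n x. 0" M] by (simp add: L0_seq_def)
    ultimately show ?thesis using notp by auto
  qed
  ultimately show ?thesis
    unfolding strongly_continuum_algebrable_def
    by (intro exI[of _ "range G"] conjI allI impI; (elim conjE)?) simp_all
qed

end
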